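(* Let $\gamma_1,\gamma_2,\gamma_3,\gamma_4,\varkappa,\varrho,\Upsilon,\zeta,\mu\in\mathbb{C}$ have positive real parts, $\varpi_1,\varpi_2\in\mathbb{C}$, $A,B\in\mathbb{R}$. For $X>A$, $Y>B$, $$\left({}_{Y}I_{B^+}^{\zeta}\,{}_{X}I_{A^+}^{\mu}\right)\left[(X-A)^{\varkappa-1}(Y-B)^{\varrho-1}E_{\varkappa,\varrho,\Upsilon}^{(\gamma_1;\gamma_2;\gamma_3;\gamma_4)}(\varpi_1(X-A),\varpi_2(Y-B))\right]$$ $$=(X-A)^{\varkappa+\mu-1}(Y-B)^{\varrho+\zeta-1}E_{\varkappa+\mu,\varrho+\zeta,\Upsilon}^{(\gamma_1;\gamma_2;\gamma_3;\gamma_4)}(\varpi_1(X-A),\varpi_2(Y-B)).$$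
   Context: $(a)_k$ is the Pochhammer symbol. The modified bivariate H–K Mittag-Leffler function is $$E_{\varkappa,\varrho,\Upsilon}^{(\gamma_1;\gamma_2;\gamma_3;\gamma_4)}(X,Y)=\sum_{s=0}^\infty\sum_{r=0}^\infty\frac{(\gamma_1)_{2s}(\gamma_2)_{s+r}X^sY^{\Upsilon r}}{(\gamma_3)_s(\gamma_4)_s\Gamma(\varkappa+s)\Gamma(\varrho+\Upsilon r)\,r!\,s!}.$$ Here $(\varpi_2(Y-B))^{\Upsilon r}=(\varpi_2^\Upsilon)^r(Y-B)^{\Upsilon r}$ with a fixed value of $\varpi_2^\Upsilon$. The double fractional integral is $$({}_{Y}I_{B^+}^{\zeta}\,{}_{X}I_{A^+}^{\mu})g(X,Y)=\frac{1}{\Gamma(\zeta)\Gamma(\mu)}\int_B^Y\int_A^X(X-\epsilon)^{\mu-1}(Y-\Omega)^{\zeta-1}g(\epsilon,\Omega)\,d\epsilon\,d\Omega.$$ *)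

theory Defs
  imports "HOL-Analysis.Analysis"
begin

text \<open>
  The branch \<open>k\<close> of the complex power \<open>z\<^sup>a\<close>, formed with the logarithm
  \<open>Ln z + 2 k \<pi> \<i>\<close>; every value of \<open>z\<^sup>a\<close> arises from some \<open>k\<close>, and \<open>k = 0\<close> is the
  principal one. Unlike \<open>powr\<close>, it satisfies \<open>0\<^sup>0 = 1\<close>, which the \<open>r = 0\<close> term of
  the series below needs at \<open>Y = 0\<close>.
\<close>

definition branch_power :: "int \<Rightarrow> complex \<Rightarrow> complex \<Rightarrow> complex" where
  "branch_power k z a =
     (if z = 0 then (if a = 0 then 1 else 0)
      else exp (a * (Ln z + 2 * of_int k * of_real pi * \<i>)))"

lemma branch_power_principal: "z \<noteq> 0 \<Longrightarrow> branch_power 0 z a = z powr a"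
  by (simp add: branch_power_def powr_def)

lemma ex_branch_power:
  assumes "exp l = z"
  shows "\<exists>k. \<forall>a. branch_power k z a = exp (a * l)"
proof -
  have "z \<noteq> 0"
    using assms by auto
  then have "exp l = exp (Ln z)"
    using assms by simp
  then obtain k :: int where "l = Ln z + of_int (2 * k) * (of_real pi * \<i>)"
    by (auto simp: exp_eq mult.assoc)
  then show ?thesis
    using \<open>z \<noteq> 0\<close> by (intro exI[of _ k]) (auto simp: branch_power_def algebra_simps)
qed

lemma branch_power_mult_of_real:
  assumes "0 < t" and "0 < Re a"
  shows "branch_power k (w * of_real t) (a * of_nat r) =
         branch_power k w a ^ r * of_real t powr (a * of_nat r)"
proof (cases "w = 0")
  case True
  have "a \<noteq> 0"
    using assms by auto
  then show ?thesis
    using True assms by (cases "r = 0") (auto simp: branch_power_def powr_def power_0_left)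
next
  case False
  then have "Ln (w * of_real t) = Ln w + of_real (ln t)"
    using assms Ln_times_of_real[of t w] by (simp add: Ln_of_real mult.commute[of w])
  then show ?thesis
    using False assms
    by (simp add: branch_power_def powr_def Ln_of_real
        flip: exp_of_nat_mult exp_add) (simp add: algebra_simps)
qed

text \<open>
  The modified bivariate H--K Mittag-Leffler function; \<open>k\<close> fixes the branch of the
  powers \<open>Y\<^bsup>\<Upsilon>r\<^esup>\<close>.
\<close>

definition HK_Mittag_Leffler ::
  "int \<Rightarrow> complex \<Rightarrow> complex \<Rightarrow> complex \<Rightarrow> complex \<Rightarrow> complex \<Rightarrow> complex \<Rightarrow> complex
    \<Rightarrow> complex \<Rightarrow> complex \<Rightarrow> complex" where
  "HK_Mittag_Leffler k \<gamma>\<^sub>1 \<gamma>\<^sub>2 \<gamma>\<^sub>3 \<gamma>\<^sub>4 \<kappa> \<rho> \<Upsilon> X Y =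
     (\<Sum>s. \<Sum>r. pochhammer \<gamma>\<^sub>1 (2 * s) * pochhammer \<gamma>\<^sub>2 (s + r)
              * X ^ s * branch_power k Y (\<Upsilon> * of_nat r)
              / (pochhammer \<gamma>\<^sub>3 s * pochhammer \<gamma>\<^sub>4 s * Gamma (\<kappa> + of_nat s)
                 * Gamma (\<rho> + \<Upsilon> * of_nat r) * fact r * fact s))"

definition double_fractional_integral ::
  "complex \<Rightarrow> real \<Rightarrow> complex \<Rightarrow> real \<Rightarrow> (real \<Rightarrow> real \<Rightarrow> complex) \<Rightarrow> real \<Rightarrow> real \<Rightarrow> complex"
where
  "double_fractional_integral \<zeta> B \<mu> A g X Y =
     1 / (Gamma \<zeta> * Gamma \<mu>) *
     (LBINT \<Omega>=B..Y. (LBINT \<epsilon>=A..X.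
        of_real (X - \<epsilon>) powr (\<mu> - 1) * of_real (Y - \<Omega>) powr (\<zeta> - 1) * g \<epsilon> \<Omega>))"

end

theory Submission
  imports Defs
begin

text \<open>
  The series is integrated term by term. Each term contributes a product of two Beta integrals,
  and \<open>Beta (\<kappa> + s) \<mu> = \<Gamma>(\<kappa> + s) \<Gamma>(\<mu>) / \<Gamma>(\<kappa> + \<mu> + s)\<close> shifts the parameter \<open>\<kappa>\<close> to \<open>\<kappa> + \<mu>\<close>
  (likewise \<open>\<rho>\<close> to \<open>\<rho> + \<zeta>\<close>). The interchange is justified by a bound of the coefficients by a
  product \<open>P s * Q r\<close> of summable sequences: up to geometric factors, the Pochhammer symbols and
  factorials cancel, and what remains, \<open>1 / (\<Gamma>(\<kappa> + s) \<Gamma>(\<rho> + \<Upsilon> r))\<close>, beats every geometric factor.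
\<close>

section \<open>Complex powers with real base, and zeros of the Gamma function\<close>

text \<open>\<open>Ln\<close> jumps along the negative axis, so continuity does not settle
  measurability there. On the nonzero reals it is \<open>ln \<bar>t\<bar>\<close> plus a constant
  depending only on the sign, which makes the power a measurable expression by cases.\<close>

lemma borel_measurable_of_real_powr [measurable (raw)]:
  assumes [measurable]: "f \<in> borel_measurable M"
  shows "(\<lambda>x. complex_of_real (f x) powr z) \<in> borel_measurable M"
proof -
  have "complex_of_real t powr z =
      (if t = 0 then 0 else exp (z * (of_real (ln \<bar>t\<bar>) + (if t < 0 then \<i> * of_real pi else 0))))" for t
  proof (cases "t < 0")
    case True
    then have "Ln (complex_of_real t) = of_real (ln (- t)) + \<i> * of_real pi"
      using Ln_minus[of "of_real (-t)"] Ln_of_real[of "- t"] by simp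
    then show ?thesis
      using True by (simp add: powr_def)
  qed (auto simp: powr_def Ln_of_real)
  then show ?thesis by simp
qed

lemma norm_of_real_powr: "0 \<le> t \<Longrightarrow> norm (complex_of_real t powr z) = t powr Re z"
  by (simp add: norm_powr_real_powr)

lemma Gamma_nonzero_right_half_plane:
  fixes z :: complex
  assumes "0 < Re z"
  shows "Gamma z \<noteq> 0"
proof
  assume "Gamma z = 0"
  then obtain n where "z = of_int n" "n \<le> 0"
    by (auto simp: Gamma_eq_zero_iff elim: nonpos_Ints_cases)
  with assms show False by simp
qed

section \<open>Beta integrals with complex parameters\<close>

text \<open>On the open unit interval the modulus of the integrand is the real Beta integrand with
  parameters \<open>Re a\<close> and \<open>Re b\<close>.\<close>

lemma set_integrable_Beta_complex:
  fixes a b :: complex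
  assumes "0 < Re a" "0 < Re b"
  shows "set_integrable lborel {0<..<1::real} (\<lambda>t. of_real t powr (a - 1) * of_real (1 - t) powr (b - 1))"
  unfolding set_integrable_def
proof (rule Bochner_Integration.integrable_bound[OF _ _ AE_I2])
  show "integrable lborel (\<lambda>t. indicat_real {0<..<1::real} t *\<^sub>R (t powr (Re a - 1) * (1 - t) powr (Re b - 1)))"
    using set_integrable_subset[OF integrable_Beta[OF assms], of "{0<..<1}"]
    unfolding set_integrable_def by (simp add: greaterThanLessThan_subseteq_atLeastAtMost_iff)
  show "norm (indicat_real {0<..<1} t *\<^sub>R (complex_of_real t powr (a - 1) * of_real (1 - t) powr (b - 1)))
      \<le> norm (indicat_real {0<..<1::real} t *\<^sub>R (t powr (Re a - 1) * (1 - t) powr (Re b - 1)))" for t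
    by (auto simp: indicator_def norm_mult norm_of_real_powr simp flip: of_real_diff)
qed measurable

text \<open>Substitute \<open>A + U * t\<close> with \<open>U = X - A\<close>: the two powers
  contribute the exponent \<open>a + b - 2\<close> and the Jacobian one more. The integral over the
  unit interval stays unevaluated because its identification with \<open>Beta a b\<close> uses this
  scaling.\<close>

lemma
  fixes a b :: complex and A X :: real
  assumes "A < X"
  defines "K \<equiv> \<lambda>A X t. of_real (X - t) powr (b - 1) * of_real (t - A) powr (a - 1) :: complex"
  shows set_integrable_powr_kernel:
      "0 < Re a \<Longrightarrow> 0 < Re b \<Longrightarrow> set_integrable lborel {A<..<X} (K A X)"
    and set_integral_powr_kernel_scale: "(LINT t:{A<..<X}|lborel. K A X t) =
        of_real (X - A) powr (a + b - 1) * (LINT t:{0<..<1}|lborel. K 0 1 t)"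
proof -
  define U where "U = X - A"
  have U: "U > 0" using assms by (simp add: U_def)
  have eq: "indicat_real {A<..<X} (A + U * t) *\<^sub>R K A X (A + U * t) =
      of_real U powr (a + b - 2) * (indicat_real {0<..<1} t *\<^sub>R K 0 1 t)" for t
  proof -
    have 1: "A + U * t \<in> {A<..<X} \<longleftrightarrow> t \<in> {0<..<1}"
    proof -
      have "A + U * t < X \<longleftrightarrow> U * t < U * 1" by (simp add: U_def algebra_simps)
      with U show ?thesis by (simp add: zero_less_mult_iff)
    qed
    show ?thesis
    proof (cases "t \<in> {0<..<1}")
      case True
      have "X - (A + U * t) = U * (1 - t)" "(A + U * t) - A = U * t"
        by (auto simp: U_def algebra_simps)
      moreover have "complex_of_real (U * (1 - t)) powr (b - 1) = of_real U powr (b - 1) * of_real (1 - t) powr (b - 1)"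
        using True U unfolding of_real_mult by (intro powr_times_real) auto
      moreover have "complex_of_real (U * t) powr (a - 1) = of_real U powr (a - 1) * of_real t powr (a - 1)"
        using True U unfolding of_real_mult by (intro powr_times_real) auto
      moreover have "complex_of_real U powr (a + b - 2) = of_real U powr (a - 1) * of_real U powr (b - 1)"
        unfolding powr_add[symmetric] by (rule arg_cong[where f = "(powr) _"]) simp
      ultimately have "K A X (A + U * t) = of_real U powr (a + b - 2) * K 0 1 t"
        unfolding K_def by (simp only: mult_ac diff_zero)
      then show ?thesis
        using True 1 by (simp only: indicator_simps scaleR_one)
    next
      case False
      with 1 show ?thesis by (simp add: indicator_def)
    qed
  qed
  have U0: "complex_of_real U powr (a + b - 2) \<noteq> 0" using U by simp
  show "set_integrable lborel {A<..<X} (K A X)" if "0 < Re a" "0 < Re b"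
  proof -
    have "set_integrable lborel {0<..<1} (K 0 1)"
      using set_integrable_Beta_complex[OF that] by (simp add: K_def mult.commute)
    then have "integrable lborel (\<lambda>t. indicat_real {A<..<X} (A + U * t) *\<^sub>R K A X (A + U * t))"
      unfolding eq set_integrable_def by (rule integrable_mult_right)
    then show ?thesis
      using U lborel_integrable_real_affine_iff[of U "\<lambda>t. indicat_real {A<..<X} t *\<^sub>R K A X t" A]
      by (simp add: set_integrable_def)
  qed
  have "(LINT t:{A<..<X}|lborel. K A X t) =
      U *\<^sub>R (LINT t|lborel. indicat_real {A<..<X} (A + U * t) *\<^sub>R K A X (A + U * t))"
    using U lborel_integral_real_affine[of U "\<lambda>t. indicat_real {A<..<X} t *\<^sub>R K A X t" A]
    by (simp add: set_lebesgue_integral_def)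
  also have "\<dots> = of_real U * (of_real U powr (a + b - 2) * (LINT t:{0<..<1}|lborel. K 0 1 t))"
    unfolding eq set_lebesgue_integral_def scaleR_conv_of_real[of U] by (subst integral_mult_right_zero) simp
  also have "\<dots> = of_real U powr (a + b - 1) * (LINT t:{0<..<1}|lborel. K 0 1 t)"
  proof -
    have "complex_of_real U * of_real U powr (a + b - 2) = of_real U powr (1 + (a + b - 2))"
      using U by (subst powr_add) simp
    moreover have "1 + (a + b - 2) = a + b - 1" by (simp add: algebra_simps)
    ultimately show ?thesis by (simp only: mult.assoc[symmetric])
  qed
  finally show "(LINT t:{A<..<X}|lborel. K A X t) =
        of_real (X - A) powr (a + b - 1) * (LINT t:{0<..<1}|lborel. K 0 1 t)"
    by (simp add: U_def)
qed

text \<open>Euler's integral, moved from the completed measure to \<open>lborel\<close> and extended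
  by zero to the whole line, where Fubini and translation invariance apply.\<close>

lemma has_bochner_integral_Gamma_complex:
  fixes z :: complex
  assumes "0 < Re z"
  shows "has_bochner_integral lborel
           (\<lambda>t. indicat_real {0<..} t *\<^sub>R (complex_of_real t powr (z - 1) / of_real (exp t))) (Gamma z)"
proof -
  let ?f = "\<lambda>t. complex_of_real t powr (z - 1) / of_real (exp t)"
  have "set_integrable lborel {0<..} ?f"
    using absolutely_integrable_Gamma_integral'[OF assms]
    unfolding set_integrable_def by (subst (asm) integrable_completion) measurable
  moreover from set_borel_integral_eq_integral(2)[OF this]
  have "(LINT t:{0<..}|lborel. ?f t) = Gamma z"
    using integral_unique[OF Gamma_integral_complex'[OF assms]] by simp
  ultimately show ?thesis
    by (simp add: has_bochner_integral_iff set_integrable_def set_lebesgue_integral_def)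
qed

text \<open>
  By Fubini, \<open>\<Gamma>(a) \<Gamma>(b)\<close> is the integral over \<open>u > 0\<close> of \<open>exp (-u)\<close> times the kernel integral on
  \<open>(0, u)\<close>, which by scaling is \<open>u\<^bsup>a+b-1\<^esup>\<close> times the one on \<open>(0, 1)\<close>.
\<close>

lemma set_integral_Beta_complex:
  fixes a b :: complex
  assumes a: "0 < Re a" and b: "0 < Re b"
  shows "(LINT t:{0<..<1}|lborel. of_real (1 - t) powr (b - 1) * of_real (t - 0) powr (a - 1)) = Beta a b"
    (is "?J = _")
proof -
  define f where "f = (\<lambda>z t. indicat_real {0<..} t *\<^sub>R (complex_of_real t powr (z - 1) / of_real (exp t)))"
  have f [measurable]: "f z \<in> borel_measurable borel" for z
    unfolding f_def by measurable
  have int: "integrable lborel (f z)" and f_Gamma: "integral\<^sup>L lborel (f z) = Gamma z" if "0 < Re z" for z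
    using has_bochner_integral_Gamma_complex[OF that] by (auto simp: f_def has_bochner_integral_iff)
  have int_shift: "integrable lborel (\<lambda>u. f b (u - t))" for t
    using lborel_integrable_real_affine[OF int[OF b], of 1 "- t"] by simp
  have shift: "(LINT u|lborel. f b (u - t)) = Gamma b" for t
    using lborel_integral_real_affine[of 1 "f b" "- t"] f_Gamma[OF b] by simp
  have shift_norm: "(LINT u|lborel. norm (f b (u - t))) = (LINT u|lborel. norm (f b u))" for t
    using lborel_integral_real_affine[of 1 "\<lambda>u. norm (f b u)" "- t"] by simp
  \<comment> \<open>By translation invariance the inner integral of the norm is a constant times
    \<open>norm (f a t)\<close>, so integrability on the plane reduces to that of
    \<open>f a\<close>.\<close>
  have "integrable (lborel \<Otimes>\<^sub>M lborel) (\<lambda>(t, u). f a t * f b (u - t))"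
  proof (rule lborel_pair.Fubini_integrable)
    show "integrable lborel (\<lambda>t. LINT u|lborel. norm (case (t, u) of (t, u) \<Rightarrow> f a t * f b (u - t)))"
      using int[OF a] by (simp add: norm_mult shift_norm)
    show "AE t in lborel. integrable lborel (\<lambda>u. case (t, u) of (t, u) \<Rightarrow> f a t * f b (u - t))"
      using int_shift by simp
  qed measurable
  from lborel_pair.Fubini_integral[OF this]
  have "(LINT u|lborel. LINT t|lborel. f a t * f b (u - t)) = (LINT t|lborel. f a t * (LINT u|lborel. f b (u - t)))"
    by simp
  also have "\<dots> = Gamma a * Gamma b"
    by (simp add: shift f_Gamma[OF a])
  also have "(\<lambda>u. LINT t|lborel. f a t * f b (u - t)) = (\<lambda>u. f (a + b) u * ?J)"
  proof
    fix u :: real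
    \<comment> \<open>The supports force \<open>0 < t < u\<close>, and the exponentials multiply to
      \<open>exp (- u)\<close>, free of \<open>t\<close>. For \<open>u \<le> 0\<close> the interval
      is empty and \<open>f (a + b) u\<close> is zero as well.\<close>
    have "f a t * f b (u - t) = of_real (exp (- u)) * (indicat_real {0<..<u} t *\<^sub>R
        (of_real (u - t) powr (b - 1) * of_real (t - 0) powr (a - 1)))" for t
      by (auto simp: f_def indicator_def exp_diff exp_minus field_simps)
    then have "(LINT t|lborel. f a t * f b (u - t)) = of_real (exp (- u)) * (LINT t:{0<..<u}|lborel.
        of_real (u - t) powr (b - 1) * of_real (t - 0) powr (a - 1))"
      by (simp only: set_lebesgue_integral_def integral_mult_right_zero)
    also have "\<dots> = f (a + b) u * ?J"
    proof (cases "0 < u")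
      case True
      from set_integral_powr_kernel_scale[OF this, of b a] True show ?thesis
        by (simp add: f_def exp_minus field_simps)
    qed (simp add: f_def set_lebesgue_integral_def)
    finally show "(LINT t|lborel. f a t * f b (u - t)) = f (a + b) u * ?J" .
  qed
  also have "(LINT u|lborel. f (a + b) u * ?J) = Gamma (a + b) * ?J"
    using a b by (simp add: f_Gamma)
  finally have "Gamma (a + b) * ?J = Gamma a * Gamma b" .
  moreover have "Gamma (a + b) \<noteq> 0"
    using a b by (intro Gamma_nonzero_right_half_plane) simp
  ultimately show ?thesis by (simp add: Beta_def field_simps)
qed

corollary set_integral_powr_kernel:
  fixes a b :: complex and A X :: real
  assumes "A < X" "0 < Re a" "0 < Re b"
  shows "(LINT t:{A<..<X}|lborel. of_real (X - t) powr (b - 1) * of_real (t - A) powr (a - 1)) =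
    of_real (X - A) powr (a + b - 1) * Beta a b"
  using set_integral_powr_kernel_scale[OF assms(1), of b a] set_integral_Beta_complex[OF assms(2,3)]
  by simp


section \<open>Growth of the Gamma function along arithmetic progressions\<close>

text \<open>
  The ratio is \<open>Beta (\<rho> + \<upsilon> n) \<upsilon> / \<Gamma>(\<upsilon>)\<close>, whose Beta integral contains the factor
  \<open>(t\<^bsup>\<upsilon>\<^esup>)\<^bsup>n\<^esup>\<close> with \<open>|t\<^bsup>\<upsilon>\<^esup>| < 1\<close>; this replaces Stirling's formula for complex arguments.
\<close>

lemma Gamma_ratio_arith_progression_tendsto_0:
  fixes \<rho> \<upsilon> :: complex
  assumes \<rho>: "0 < Re \<rho>" and \<upsilon>: "0 < Re \<upsilon>"
  shows "(\<lambda>n. Gamma (\<rho> + \<upsilon> * of_nat n) / Gamma (\<rho> + \<upsilon> * of_nat (Suc n))) \<longlonglongrightarrow> 0"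
proof -
  define K where "K = (\<lambda>t. indicat_real {0<..<1} t *\<^sub>R
      (complex_of_real (1 - t) powr (\<upsilon> - 1) * of_real (t - 0) powr (\<rho> - 1)))"
  have K: "integrable lborel K"
    using set_integrable_powr_kernel[of 0 1 \<rho> \<upsilon>] \<rho> \<upsilon> by (simp add: K_def set_integrable_def)
  have [measurable]: "K \<in> borel_measurable borel"
    unfolding K_def by measurable
  have norm_t: "norm (complex_of_real t powr \<upsilon>) < 1" if "t \<in> {0<..<1}" for t
    using that \<upsilon> powr_less_mono2[of "Re \<upsilon>" t 1] by (simp add: norm_of_real_powr)
  have "(\<lambda>n. LINT t|lborel. K t * (of_real t powr \<upsilon>) ^ n) \<longlonglongrightarrow> (LINT (t::real)|lborel. 0 :: complex)"
  proof (rule integral_dominated_convergence[where w = "\<lambda>t. norm (K t)"])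
    show "AE t in lborel. (\<lambda>n. K t * (complex_of_real t powr \<upsilon>) ^ n) \<longlonglongrightarrow> 0"
    proof (rule AE_I2)
      fix t :: real
      show "(\<lambda>n. K t * (complex_of_real t powr \<upsilon>) ^ n) \<longlonglongrightarrow> 0"
      proof (cases "t \<in> {0<..<1}")
        case True
        from tendsto_mult_right_zero[OF LIMSEQ_power_zero[OF norm_t[OF this]]] show ?thesis .
      qed (simp add: K_def)
    qed
    show "AE t in lborel. norm (K t * (complex_of_real t powr \<upsilon>) ^ n) \<le> norm (K t)" for n
    proof (rule AE_I2)
      fix t :: real
      show "norm (K t * (complex_of_real t powr \<upsilon>) ^ n) \<le> norm (K t)"
      proof (cases "t \<in> {0<..<1}")
        case True
        have "norm (complex_of_real t powr \<upsilon>) ^ n \<le> 1"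
          using norm_t[OF True] by (intro power_le_one) auto
        then show ?thesis
          by (simp add: norm_mult norm_power mult_left_le)
      qed (simp add: K_def)
    qed
  qed (use K in auto)
  also have "(\<lambda>n. LINT t|lborel. K t * (of_real t powr \<upsilon>) ^ n) = (\<lambda>n. Beta (\<rho> + \<upsilon> * of_nat n) \<upsilon>)"
  proof
    fix n
    have "K t * (of_real t powr \<upsilon>) ^ n = indicat_real {0<..<1} t *\<^sub>R
        (complex_of_real (1 - t) powr (\<upsilon> - 1) * of_real (t - 0) powr (\<rho> + \<upsilon> * of_nat n - 1))" for t
      by (cases "t \<in> {0<..<1}")
        (auto simp: K_def powr_def algebra_simps simp flip: exp_of_nat_mult exp_add)
    then show "(LINT t|lborel. K t * (of_real t powr \<upsilon>) ^ n) = Beta (\<rho> + \<upsilon> * of_nat n) \<upsilon>"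
      using set_integral_Beta_complex[of "\<rho> + \<upsilon> * of_nat n" \<upsilon>] \<rho> \<upsilon>
      by (simp add: set_lebesgue_integral_def add_pos_nonneg)
  qed
  finally have "(\<lambda>n. Beta (\<rho> + \<upsilon> * of_nat n) \<upsilon> / Gamma \<upsilon>) \<longlonglongrightarrow> 0"
    by (simp add: tendsto_divide_zero)
  \<comment> \<open>The second Beta parameter is the step of the progression, so the sum of the two
    parameters is its next member.\<close>
  moreover have "Beta (\<rho> + \<upsilon> * of_nat n) \<upsilon> / Gamma \<upsilon> =
      Gamma (\<rho> + \<upsilon> * of_nat n) / Gamma (\<rho> + \<upsilon> * of_nat (Suc n))" for n
    using Gamma_nonzero_right_half_plane[OF \<upsilon>] by (simp add: Beta_def algebra_simps)
  ultimately show ?thesis by simp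
qed

text \<open>The quotient of consecutive terms is \<open>x\<close> times a Gamma ratio whose norm
  tends to zero, so the ratio test succeeds for every \<open>x\<close>.\<close>

lemma summable_power_over_Gamma:
  fixes \<rho> \<upsilon> :: complex and x :: real
  assumes \<rho>: "0 < Re \<rho>" and \<upsilon>: "0 < Re \<upsilon>"
  shows "summable (\<lambda>n. x ^ n / norm (Gamma (\<rho> + \<upsilon> * of_nat n)))"
proof -
  define G where "G = (\<lambda>n. Gamma (\<rho> + \<upsilon> * of_nat n))"
  have G: "G n \<noteq> 0" for n
    unfolding G_def using assms by (intro Gamma_nonzero_right_half_plane) (simp add: add_pos_nonneg)
  have "(\<lambda>n. \<bar>x\<bar> * norm (G n / G (Suc n))) \<longlonglongrightarrow> 0"
    using Gamma_ratio_arith_progression_tendsto_0[OF assms] unfolding G_def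
    by (intro tendsto_mult_right_zero tendsto_norm_zero)
  then have "eventually (\<lambda>n. \<bar>x\<bar> * norm (G n / G (Suc n)) < 1/2) sequentially"
    by (rule order_tendstoD) simp
  then obtain N where N: "\<bar>x\<bar> * norm (G n / G (Suc n)) < 1/2" if "n \<ge> N" for n
    by (auto simp: eventually_sequentially)
  have "summable (\<lambda>n. x ^ n / norm (G n))"
  proof (rule summable_ratio_test[of "1/2" N])
    fix n assume "n \<ge> N"
    have "norm (x ^ Suc n / norm (G (Suc n))) = (\<bar>x\<bar> * norm (G n / G (Suc n))) * norm (x ^ n / norm (G n))"
      using G by (simp add: norm_divide abs_mult power_abs)
    also have "\<dots> \<le> 1/2 * norm (x ^ n / norm (G n))"
      using N[OF \<open>n \<ge> N\<close>] by (intro mult_right_mono) auto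
    finally show "norm (x ^ Suc n / norm (G (Suc n))) \<le> 1/2 * norm (x ^ n / norm (G n))" .
  qed simp
  then show ?thesis by (simp add: G_def)
qed

section \<open>Geometric bounds for quotients of Pochhammer symbols\<close>

text \<open>Comparison with the factorial factor by factor: \<open>norm (z + of_nat n)\<close> is at
  most \<open>max 1 (norm z) * (n + 1)\<close>, where the \<open>1\<close> in the maximum absorbs
  the summand \<open>n\<close>.\<close>

lemma norm_pochhammer_le:
  fixes z :: "'a :: real_normed_field"
  shows "norm (pochhammer z n) \<le> (max 1 (norm z)) ^ n * fact n"
proof (induction n)
  case (Suc n)
  have "norm (z + of_nat n) \<le> norm z + real n"
    using norm_triangle_ineq[of z "of_nat n"] by simp
  also have "\<dots> \<le> max 1 (norm z) + max 1 (norm z) * real n"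
    using mult_right_mono[of 1 "max 1 (norm z)" "real n"] by simp
  finally have "norm (pochhammer z n) * norm (z + of_nat n) \<le>
      ((max 1 (norm z)) ^ n * fact n) * (max 1 (norm z) * real (Suc n))"
    using Suc by (intro mult_mono) (auto simp: algebra_simps)
  then show ?case
    by (simp only: pochhammer_Suc norm_mult power_Suc fact_Suc mult_ac)
qed simp

text \<open>Each factor has real part \<open>Re z + n\<close>, which is at least
  \<open>min 1 (Re z) * (n + 1)\<close>. The minimum is positive, so the bound can serve in
  denominators.\<close>

lemma norm_pochhammer_ge:
  fixes z :: complex
  assumes "0 < Re z"
  shows "(min 1 (Re z)) ^ n * fact n \<le> norm (pochhammer z n)"
proof (induction n)
  case (Suc n)
  have "min 1 (Re z) * real (Suc n) = min 1 (Re z) + min 1 (Re z) * real n"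
    by (simp add: algebra_simps)
  also have "\<dots> \<le> Re z + 1 * real n"
    by (intro add_mono mult_right_mono) auto
  also have "\<dots> \<le> norm (z + of_nat n)"
    using complex_Re_le_cmod[of "z + of_nat n"] by simp
  finally have "((min 1 (Re z)) ^ n * fact n) * (min 1 (Re z) * real (Suc n)) \<le>
      norm (pochhammer z n) * norm (z + of_nat n)"
    using Suc assms by (intro mult_mono) auto
  then show ?case
    by (simp only: pochhammer_Suc norm_mult power_Suc fact_Suc mult_ac)
qed simp

text \<open>The quotient of the factorials is a binomial coefficient, one summand of the expansion
  of \<open>2 ^ (m + n)\<close>.\<close>

lemma fact_add_le: "(fact (m + n) :: real) \<le> 2 ^ (m + n) * fact m * fact n"
proof -
  have "real (fact m * fact n * ((m + n) choose m)) = fact (m + n)"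
    using binomial_fact_lemma[of m "m + n"] by simp
  moreover have "real ((m + n) choose m) \<le> 2 ^ (m + n)"
    using binomial_le_pow2[of "m + n" m] by (metis of_nat_le_iff of_nat_numeral of_nat_power)
  ultimately show ?thesis
    using mult_left_mono[of "real ((m + n) choose m)" "2 ^ (m + n)" "fact m * fact n"]
    by (simp add: mult_ac)
qed

text \<open>Splitting \<open>fact (2 * s)\<close> and \<open>fact (s + r)\<close> by
  \<open>fact_add_le\<close> yields three factors \<open>fact s\<close> and one
  \<open>fact r\<close> above, exactly as many as below, so only geometric factors survive.\<close>

lemma pochhammer_quotient_bound:
  fixes \<gamma>\<^sub>1 \<gamma>\<^sub>2 \<gamma>\<^sub>3 \<gamma>\<^sub>4 :: complex
  assumes "0 < Re \<gamma>\<^sub>3" and "0 < Re \<gamma>\<^sub>4"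
  shows "\<exists>C D :: real. \<forall>s r.
    norm (pochhammer \<gamma>\<^sub>1 (2 * s) * pochhammer \<gamma>\<^sub>2 (s + r) /
      (pochhammer \<gamma>\<^sub>3 s * pochhammer \<gamma>\<^sub>4 s * fact r * fact s)) \<le> C ^ s * D ^ r"
proof -
  define a where "a = max 1 (norm \<gamma>\<^sub>1)"
  define b where "b = max 1 (norm \<gamma>\<^sub>2)"
  define c where "c = min 1 (Re \<gamma>\<^sub>3)"
  define d where "d = min 1 (Re \<gamma>\<^sub>4)"
  have pos: "0 < a" "0 < b" "0 < c" "0 < d"
    using assms by (auto simp: a_def b_def c_def d_def)
  \<comment> \<open>The \<open>8\<close> collects \<open>4\<close> from splitting
    \<open>fact (2 * s)\<close> and \<open>2\<close> from splitting \<open>fact (s + r)\<close>; the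
    latter also gives the \<open>2\<close> beside \<open>b\<close> in the power with exponent
    \<open>r\<close>.\<close>
  have "norm (pochhammer \<gamma>\<^sub>1 (2 * s) * pochhammer \<gamma>\<^sub>2 (s + r) /
           (pochhammer \<gamma>\<^sub>3 s * pochhammer \<gamma>\<^sub>4 s * fact r * fact s))
         \<le> (8 * a\<^sup>2 * b / (c * d)) ^ s * (2 * b) ^ r" for s r
  proof -
    have 1: "norm (pochhammer \<gamma>\<^sub>1 (2 * s)) \<le> a ^ (2 * s) * (2 ^ (s + s) * fact s * fact s)"
      using norm_pochhammer_le[of \<gamma>\<^sub>1 "2 * s"] fact_add_le[of s s] pos(1)
      by (auto simp: a_def mult_2 intro: order_trans[OF _ mult_left_mono])
    have 2: "norm (pochhammer \<gamma>\<^sub>2 (s + r)) \<le> b ^ (s + r) * (2 ^ (s + r) * fact s * fact r)"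
      using norm_pochhammer_le[of \<gamma>\<^sub>2 "s + r"] fact_add_le[of s r] pos(2)
      by (auto simp: b_def intro: order_trans[OF _ mult_left_mono])
    have 3: "c ^ s * fact s \<le> norm (pochhammer \<gamma>\<^sub>3 s)" "d ^ s * fact s \<le> norm (pochhammer \<gamma>\<^sub>4 s)"
      using norm_pochhammer_ge assms by (auto simp: c_def d_def)
    have "norm (pochhammer \<gamma>\<^sub>1 (2 * s) * pochhammer \<gamma>\<^sub>2 (s + r) /
           (pochhammer \<gamma>\<^sub>3 s * pochhammer \<gamma>\<^sub>4 s * fact r * fact s))
        = norm (pochhammer \<gamma>\<^sub>1 (2 * s)) * norm (pochhammer \<gamma>\<^sub>2 (s + r)) /
           (norm (pochhammer \<gamma>\<^sub>3 s) * norm (pochhammer \<gamma>\<^sub>4 s) * fact r * fact s)"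
      by (simp add: norm_mult norm_divide)
    also have "\<dots> \<le> (a ^ (2 * s) * (2 ^ (s + s) * fact s * fact s)) * (b ^ (s + r) * (2 ^ (s + r) * fact s * fact r))
        / ((c ^ s * fact s) * (d ^ s * fact s) * fact r * fact s)"
      using 1 2 3 pos by (intro frac_le mult_mono mult_nonneg_nonneg mult_pos_pos) auto
    also have "\<dots> = (a ^ (2 * s) * (2 ^ (s + s)) * (b ^ (s + r) * 2 ^ (s + r))) / (c ^ s * d ^ s)"
      using pos by (simp add: field_simps)
    also have "\<dots> = (8 * a\<^sup>2 * b / (c * d)) ^ s * (2 * b) ^ r"
    proof -
      have "(8::real) ^ s = 2 ^ s * 2 ^ s * 2 ^ s"
        by (simp flip: power_mult_distrib)
      then show ?thesis
        by (simp add: power_add power_mult power_mult_distrib power_divide)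
    qed
    finally show ?thesis .
  qed
  with pos show ?thesis
    by (intro exI[of _ "8 * a\<^sup>2 * b / (c * d)"] exI[of _ "2 * b"]) auto
qed

section \<open>Termwise integration of iterated series\<close>

text \<open>A majorant in product form bounds each row by a multiple of \<open>Q\<close> and the row
  sums by a multiple of \<open>P\<close>, so nested sums can be treated one index at a time.\<close>

lemma
  fixes a :: "nat \<Rightarrow> nat \<Rightarrow> 'a :: banach"
  assumes le: "\<And>s r. norm (a s r) \<le> P s * Q r" and P: "summable P" and Q: "summable Q"
  shows summable_inner_product_bound: "summable (a s)"
    and norm_suminf_product_bound: "norm (\<Sum>r. a s r) \<le> P s * suminf Q"
    and summable_outer_product_bound: "summable (\<lambda>s. \<Sum>r. a s r)"
proof -
  show "summable (a s)" for s
    using le by (intro summable_comparison_test'[OF summable_mult[OF Q]])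
  show *: "norm (\<Sum>r. a s r) \<le> P s * suminf Q" for s
    using norm_suminf_le[of "a s" "\<lambda>r. P s * Q r"] le summable_mult[OF Q] suminf_mult[OF Q] by simp
  show "summable (\<lambda>s. \<Sum>r. a s r)"
    using * by (intro summable_comparison_test'[OF summable_mult2[OF P]])
qed

lemma set_integrable_mult_bounded:
  fixes K f :: "'b \<Rightarrow> 'a :: {real_normed_field, banach, second_countable_topology}"
  assumes K: "set_integrable M S K" and f: "f \<in> borel_measurable M"
    and le: "\<And>x. x \<in> S \<Longrightarrow> norm (f x) \<le> B"
  shows "set_integrable M S (\<lambda>x. K x * f x)"
proof -
  have "integrable M (\<lambda>x. (indicat_real S x *\<^sub>R K x) * f x)"
  proof (rule Bochner_Integration.integrable_bound[OF _ _ AE_I2])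
    show "integrable M (\<lambda>x. norm (indicat_real S x *\<^sub>R K x) * B)"
      using K unfolding set_integrable_def by (intro integrable_mult_left integrable_norm) auto
    show "norm (indicat_real S x *\<^sub>R K x * f x) \<le> norm (norm (indicat_real S x *\<^sub>R K x) * B)" for x
      using order_trans[OF le abs_ge_self]
      by (auto simp: indicator_def norm_mult abs_mult intro: mult_left_mono)
    show "(\<lambda>x. indicat_real S x *\<^sub>R K x * f x) \<in> borel_measurable M"
      using K f unfolding set_integrable_def by (intro borel_measurable_times) auto
  qed
  then show ?thesis by (simp add: set_integrable_def)
qed

text \<open>The kernel may be unbounded, so it is kept apart from the terms: \<open>K\<close>
  supplies integrability and \<open>B\<close> summability, and the integrals of the norms are at
  most \<open>B n\<close> times the integral of the norm of \<open>K\<close>.\<close>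

lemma set_integral_mult_suminf:
  fixes f :: "nat \<Rightarrow> 'b \<Rightarrow> 'a :: {real_normed_field, banach, second_countable_topology}"
  assumes K: "set_integrable M S K"
    and f [measurable]: "\<And>n. f n \<in> borel_measurable M"
    and le: "\<And>n x. x \<in> S \<Longrightarrow> norm (f n x) \<le> B n" and B: "summable B"
  shows "(LINT x:S|M. K x * (\<Sum>n. f n x)) = (\<Sum>n. LINT x:S|M. K x * f n x)"
proof -
  define K' where "K' = (\<lambda>x. indicat_real S x *\<^sub>R K x)"
  have K': "integrable M K'" using K by (simp add: K'_def set_integrable_def)
  have le': "norm (K' x * f n x) \<le> norm (K' x) * B n" for n x
    using le[of x n] by (cases "x \<in> S") (auto simp: K'_def norm_mult intro: mult_left_mono)
  have int: "integrable M (\<lambda>x. K' x * f n x)" for n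
    using set_integrable_mult_bounded[OF K f le] by (simp add: K'_def set_integrable_def)
  have "(LINT x:S|M. K x * (\<Sum>n. f n x)) = (LINT x|M. (\<Sum>n. K' x * f n x))"
    unfolding set_lebesgue_integral_def
  proof (rule Bochner_Integration.integral_cong[OF refl])
    fix x
    show "indicat_real S x *\<^sub>R (K x * (\<Sum>n. f n x)) = (\<Sum>n. K' x * f n x)"
    proof (cases "x \<in> S")
      case True
      then have "summable (\<lambda>n. f n x)"
        using le by (intro summable_comparison_test'[OF B])
      from suminf_mult[OF this, of "K x"] True show ?thesis by (simp add: K'_def)
    qed (simp add: K'_def)
  qed
  also have "\<dots> = (\<Sum>n. LINT x|M. K' x * f n x)"
  proof (rule integral_suminf[OF int])
    show "AE x in M. summable (\<lambda>n. norm (K' x * f n x))"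
      using le' by (intro AE_I2 summable_comparison_test'[OF summable_mult[OF B]]) simp
    show "summable (\<lambda>n. LINT x|M. norm (K' x * f n x))"
    proof (rule summable_comparison_test'[OF summable_mult[OF B]])
      fix n
      have "(LINT x|M. norm (K' x * f n x)) \<le> (LINT x|M. norm (K' x) * B n)"
        using le' int K' by (intro integral_mono) auto
      then show "norm (LINT x|M. norm (K' x * f n x)) \<le> (LINT x|M. norm (K' x)) * B n"
        by simp
    qed
  qed
  finally show ?thesis
    by (simp add: K'_def set_lebesgue_integral_def)
qed

text \<open>Carries a bound on the terms past the first integration; it grows only by the integral
  of the norm of \<open>K\<close>, the same factor for all terms.\<close>

lemma norm_set_integral_mult_le:
  fixes K f :: "'b \<Rightarrow> 'a :: {real_normed_field, banach, second_countable_topology}"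
  assumes K: "set_integrable M S K" and f: "f \<in> borel_measurable M"
    and le: "\<And>x. x \<in> S \<Longrightarrow> norm (f x) \<le> B"
  shows "norm (LINT x:S|M. K x * f x) \<le> (LINT x:S|M. norm (K x)) * B"
proof -
  have set_integrable: "set_integrable M S (\<lambda>x. K x * f x)"
    using K f le by (rule set_integrable_mult_bounded)
  have "norm (LINT x:S|M. K x * f x) \<le> (LINT x|M. norm (indicat_real S x *\<^sub>R (K x * f x)))"
    unfolding set_lebesgue_integral_def by (rule integral_norm_bound)
  also have "\<dots> \<le> (LINT x|M. norm (indicat_real S x *\<^sub>R K x) * B)"
  proof (rule integral_mono)
    show "integrable M (\<lambda>x. norm (indicat_real S x *\<^sub>R (K x * f x)))"
      using set_integrable unfolding set_integrable_def by (rule integrable_norm)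
    show "integrable M (\<lambda>x. norm (indicat_real S x *\<^sub>R K x) * B)"
      using K unfolding set_integrable_def by (intro integrable_mult_left integrable_norm) auto
    show "norm (indicat_real S x *\<^sub>R (K x * f x)) \<le> norm (indicat_real S x *\<^sub>R K x) * B" for x
      using le by (auto simp: indicator_def norm_mult intro: mult_left_mono)
  qed
  finally show ?thesis
    by (simp add: set_lebesgue_integral_def)
qed

text \<open>With separated variables the series leaves the integral over \<open>x\<close> for fixed
  \<open>y\<close>, then the integral over \<open>y\<close>. Each round moves the sum over
  \<open>s\<close> first and the sum over \<open>r\<close> second, with majorants built from
  \<open>P\<close> and \<open>Q\<close>.\<close>

lemma double_set_integral_suminf:
  fixes a :: "nat \<Rightarrow> nat \<Rightarrow> 'a :: {real_normed_field, banach, second_countable_topology}"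
  assumes K: "set_integrable M S K" and L: "set_integrable N T L"
    and \<phi> [measurable]: "\<And>s. \<phi> s \<in> borel_measurable M"
    and \<psi> [measurable]: "\<And>r. \<psi> r \<in> borel_measurable N"
    and \<phi>_le: "\<And>s x. x \<in> S \<Longrightarrow> norm (\<phi> s x) \<le> p s"
    and \<psi>_le: "\<And>r y. y \<in> T \<Longrightarrow> norm (\<psi> r y) \<le> q r"
    and p: "\<And>s. 0 \<le> p s" and q: "\<And>r. 0 \<le> q r"
    and a_le: "\<And>s r. norm (a s r) * p s * q r \<le> P s * Q r" and P: "summable P" and Q: "summable Q"
  shows "(LINT y:T|N. LINT x:S|M. K x * L y * (\<Sum>s. \<Sum>r. a s r * \<phi> s x * \<psi> r y)) =
         (\<Sum>s. \<Sum>r. a s r * (LINT x:S|M. K x * \<phi> s x) * (LINT y:T|N. L y * \<psi> r y))"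
proof -
  \<comment> \<open>One estimate for both rounds: \<open>u\<close> is \<open>\<phi> s x\<close> with
    factor \<open>1\<close> in the first, and the integral \<open>I s\<close> with the integral of
    the norm of \<open>K\<close> as factor in the second.\<close>
  have bound: "norm (a s r * u * \<psi> r y) \<le> c * P s * Q r"
    if "y \<in> T" "norm u \<le> c * p s" "0 \<le> c" for s r y u c
  proof -
    have "norm (a s r * u * \<psi> r y) \<le> norm (a s r) * (c * p s) * q r"
      using \<psi>_le[OF that(1), of r] that(2,3) q p
      by (auto simp: norm_mult intro!: mult_mono mult_nonneg_nonneg)
    also have "\<dots> \<le> c * (P s * Q r)"
      using mult_left_mono[OF a_le that(3), of s r] by (simp add: mult_ac)
    finally show ?thesis by (simp add: mult_ac)
  qed
  define I where "I = (\<lambda>s. LINT x:S|M. K x * \<phi> s x)"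
  define c where "c = (LINT x:S|M. norm (K x))"
  have c: "0 \<le> c"
    unfolding c_def set_lebesgue_integral_def by (intro Bochner_Integration.integral_nonneg) auto
  have I_le: "norm (I s) \<le> c * p s" for s
    unfolding I_def c_def using K \<phi> \<phi>_le by (intro norm_set_integral_mult_le)
  have f_le: "norm (a s r * \<phi> s x * \<psi> r y) \<le> P s * Q r" if "x \<in> S" "y \<in> T" for s r x y
    using bound[OF that(2), of "\<phi> s x" 1 s r] \<phi>_le[OF that(1), of s] by simp
  have g_le: "norm (a s r * I s * \<psi> r y) \<le> c * P s * Q r" if "y \<in> T" for s r y
    using bound[OF that I_le c] .
  have "(LINT x:S|M. K x * L y * (\<Sum>s. \<Sum>r. a s r * \<phi> s x * \<psi> r y)) =
      L y * (\<Sum>s. \<Sum>r. a s r * I s * \<psi> r y)" if y: "y \<in> T" for y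
  proof -
    have "(LINT x:S|M. K x * L y * (\<Sum>s. \<Sum>r. a s r * \<phi> s x * \<psi> r y)) =
        L y * (LINT x:S|M. K x * (\<Sum>s. \<Sum>r. a s r * \<phi> s x * \<psi> r y))"
      by (simp add: mult_ac flip: set_integral_mult_right)
    \<comment> \<open>The summands in \<open>s\<close> are whole rows, bounded by
      \<open>P s * suminf Q\<close>; the rows themselves are resolved afterwards.\<close>
    also have "(LINT x:S|M. K x * (\<Sum>s. \<Sum>r. a s r * \<phi> s x * \<psi> r y)) =
        (\<Sum>s. LINT x:S|M. K x * (\<Sum>r. a s r * \<phi> s x * \<psi> r y))"
      using norm_suminf_product_bound[of "\<lambda>s r. a s r * \<phi> s _ * \<psi> r y", OF f_le P Q] y
      by (intro set_integral_mult_suminf[OF K _ _ summable_mult2[OF P]]) auto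
    also have "\<dots> = (\<Sum>s. \<Sum>r. LINT x:S|M. K x * (a s r * \<phi> s x * \<psi> r y))"
      using f_le y by (intro suminf_cong set_integral_mult_suminf[OF K _ _ summable_mult[OF Q]]) auto
    also have "\<dots> = (\<Sum>s. \<Sum>r. a s r * I s * \<psi> r y)"
      unfolding I_def by (intro suminf_cong) (simp add: mult_ac flip: set_integral_mult_right)
    finally show ?thesis .
  qed
  then have "(LINT y:T|N. LINT x:S|M. K x * L y * (\<Sum>s. \<Sum>r. a s r * \<phi> s x * \<psi> r y)) =
      (LINT y:T|N. L y * (\<Sum>s. \<Sum>r. a s r * I s * \<psi> r y))"
    unfolding set_lebesgue_integral_def by (intro Bochner_Integration.integral_cong) (auto simp: indicator_def)
  also have "\<dots> = (\<Sum>s. LINT y:T|N. L y * (\<Sum>r. a s r * I s * \<psi> r y))"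
    using norm_suminf_product_bound[of "\<lambda>s r. a s r * I s * \<psi> r _", OF g_le summable_mult[OF P] Q]
    by (intro set_integral_mult_suminf[OF L _ _ summable_mult2[OF summable_mult[OF P]]]) auto
  also have "\<dots> = (\<Sum>s. \<Sum>r. LINT y:T|N. L y * (a s r * I s * \<psi> r y))"
    using g_le by (intro suminf_cong set_integral_mult_suminf[OF L _ _ summable_mult[OF Q]]) auto
  also have "\<dots> = (\<Sum>s. \<Sum>r. a s r * I s * (LINT y:T|N. L y * \<psi> r y))"
    by (intro suminf_cong) (simp add: mult_ac flip: set_integral_mult_right)
  finally show ?thesis
    by (simp add: I_def)
qed

section \<open>Coefficients of the Mittag-Leffler series and their majorants\<close>

text \<open>The division is split so that \<open>\<kappa>\<close> and \<open>\<rho>\<close> occur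
  only in the last divisor, the part altered by integration, while the first quotient is the one in
  \<open>pochhammer_quotient_bound\<close>.\<close>

definition HK_coefficient ::
  "complex \<Rightarrow> complex \<Rightarrow> complex \<Rightarrow> complex \<Rightarrow> complex \<Rightarrow> complex \<Rightarrow> complex \<Rightarrow> nat \<Rightarrow> nat \<Rightarrow> complex"
where
  "HK_coefficient \<gamma>\<^sub>1 \<gamma>\<^sub>2 \<gamma>\<^sub>3 \<gamma>\<^sub>4 \<kappa> \<rho> \<Upsilon> s r =
     pochhammer \<gamma>\<^sub>1 (2 * s) * pochhammer \<gamma>\<^sub>2 (s + r) /
       (pochhammer \<gamma>\<^sub>3 s * pochhammer \<gamma>\<^sub>4 s * fact r * fact s) /
       (Gamma (\<kappa> + of_nat s) * Gamma (\<rho> + \<Upsilon> * of_nat r))"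

text \<open>A positive factor \<open>v\<close> leaves the branch power as a principal power, so the
  branch \<open>k\<close> affects only the constant
  \<open>branch_power k \<omega>\<^sub>2 \<Upsilon>\<close>.\<close>

lemma HK_Mittag_Leffler_of_real:
  assumes "0 < v" and "0 < Re \<Upsilon>"
  shows "HK_Mittag_Leffler k \<gamma>\<^sub>1 \<gamma>\<^sub>2 \<gamma>\<^sub>3 \<gamma>\<^sub>4 \<kappa> \<rho> \<Upsilon> (\<omega>\<^sub>1 * of_real u) (\<omega>\<^sub>2 * of_real v) =
    (\<Sum>s. \<Sum>r. HK_coefficient \<gamma>\<^sub>1 \<gamma>\<^sub>2 \<gamma>\<^sub>3 \<gamma>\<^sub>4 \<kappa> \<rho> \<Upsilon> s r * \<omega>\<^sub>1 ^ s * branch_power k \<omega>\<^sub>2 \<Upsilon> ^ r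
       * of_real u ^ s * of_real v powr (\<Upsilon> * of_nat r))"
  unfolding HK_Mittag_Leffler_def HK_coefficient_def branch_power_mult_of_real[OF assms]
  by (intro suminf_cong) (simp add: power_mult_distrib mult_ac)

text \<open>All geometric factors merge into a power divided by a Gamma value, summable for any
  base. The weights \<open>p\<close> and \<open>q\<close> make room for bounds on the monomials over
  the rectangle of integration.\<close>

lemma HK_coefficient_product_bound:
  fixes \<gamma>\<^sub>1 \<gamma>\<^sub>2 \<gamma>\<^sub>3 \<gamma>\<^sub>4 \<kappa> \<rho> \<Upsilon> w z :: complex and p q :: real
  assumes "0 < Re \<gamma>\<^sub>3" and "0 < Re \<gamma>\<^sub>4" and \<kappa>: "0 < Re \<kappa>" and \<rho>: "0 < Re \<rho>" and \<Upsilon>: "0 < Re \<Upsilon>"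
    and "0 \<le> p" and "0 \<le> q"
  shows "\<exists>P Q. summable P \<and> summable Q \<and> (\<forall>s r.
    norm (HK_coefficient \<gamma>\<^sub>1 \<gamma>\<^sub>2 \<gamma>\<^sub>3 \<gamma>\<^sub>4 \<kappa> \<rho> \<Upsilon> s r * w ^ s * z ^ r) * p ^ s * q ^ r \<le> P s * Q r)"
proof -
  obtain C D :: real where CD:
    "norm (pochhammer \<gamma>\<^sub>1 (2 * s) * pochhammer \<gamma>\<^sub>2 (s + r) /
       (pochhammer \<gamma>\<^sub>3 s * pochhammer \<gamma>\<^sub>4 s * fact r * fact s)) \<le> C ^ s * D ^ r" for s r
    using pochhammer_quotient_bound[OF assms(1,2), of \<gamma>\<^sub>1 \<gamma>\<^sub>2] by blast
  \<comment> \<open>The factor \<open>1\<close> exhibits \<open>\<kappa> + s\<close> as an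
    arithmetic progression of step one, the form in
    \<open>summable_power_over_Gamma\<close>.\<close>
  define P where "P = (\<lambda>s. (C * norm w * p) ^ s / norm (Gamma (\<kappa> + 1 * of_nat s)))"
  define Q where "Q = (\<lambda>r. (D * norm z * q) ^ r / norm (Gamma (\<rho> + \<Upsilon> * of_nat r)))"
  show ?thesis
  proof (intro exI conjI allI)
    show "summable P" "summable Q"
      unfolding P_def Q_def using \<kappa> \<rho> \<Upsilon> by (intro summable_power_over_Gamma; simp)+
    fix s r
    let ?c = "pochhammer \<gamma>\<^sub>1 (2 * s) * pochhammer \<gamma>\<^sub>2 (s + r) /
       (pochhammer \<gamma>\<^sub>3 s * pochhammer \<gamma>\<^sub>4 s * fact r * fact s)"
    let ?d = "norm w ^ s * norm z ^ r * p ^ s * q ^ r /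
       (norm (Gamma (\<kappa> + of_nat s)) * norm (Gamma (\<rho> + \<Upsilon> * of_nat r)))"
    have "norm (HK_coefficient \<gamma>\<^sub>1 \<gamma>\<^sub>2 \<gamma>\<^sub>3 \<gamma>\<^sub>4 \<kappa> \<rho> \<Upsilon> s r * w ^ s * z ^ r) * p ^ s * q ^ r = norm ?c * ?d"
      unfolding HK_coefficient_def by (simp add: norm_mult norm_divide norm_power)
    also have "\<dots> \<le> (C ^ s * D ^ r) * ?d"
      using CD[of s r] assms by (intro mult_right_mono) auto
    also have "\<dots> = P s * Q r"
      by (simp add: P_def Q_def power_mult_distrib)
    finally show "norm (HK_coefficient \<gamma>\<^sub>1 \<gamma>\<^sub>2 \<gamma>\<^sub>3 \<gamma>\<^sub>4 \<kappa> \<rho> \<Upsilon> s r * w ^ s * z ^ r) * p ^ s * q ^ r \<le> P s * Q r" .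
  qed
qed

section \<open>Evaluation of the double fractional integral\<close>

theorem theorem15:
  fixes \<gamma>\<^sub>1 \<gamma>\<^sub>2 \<gamma>\<^sub>3 \<gamma>\<^sub>4 \<kappa> \<rho> \<Upsilon> \<zeta> \<mu> \<omega>\<^sub>1 \<omega>\<^sub>2 :: complex
    and A B X Y :: real
    and k :: int
  assumes "0 < Re \<gamma>\<^sub>1" and "0 < Re \<gamma>\<^sub>2" and "0 < Re \<gamma>\<^sub>3" and "0 < Re \<gamma>\<^sub>4"
    and "0 < Re \<kappa>" and "0 < Re \<rho>" and "0 < Re \<Upsilon>" and "0 < Re \<zeta>" and "0 < Re \<mu>"
    and "A < X" and "B < Y"
  shows "double_fractional_integral \<zeta> B \<mu> A
           (\<lambda>x y. of_real (x - A) powr (\<kappa> - 1) * of_real (y - B) powr (\<rho> - 1)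
                  * HK_Mittag_Leffler k \<gamma>\<^sub>1 \<gamma>\<^sub>2 \<gamma>\<^sub>3 \<gamma>\<^sub>4 \<kappa> \<rho> \<Upsilon>
                      (\<omega>\<^sub>1 * of_real (x - A)) (\<omega>\<^sub>2 * of_real (y - B))) X Y
         = of_real (X - A) powr (\<kappa> + \<mu> - 1) * of_real (Y - B) powr (\<rho> + \<zeta> - 1)
           * HK_Mittag_Leffler k \<gamma>\<^sub>1 \<gamma>\<^sub>2 \<gamma>\<^sub>3 \<gamma>\<^sub>4 (\<kappa> + \<mu>) (\<rho> + \<zeta>) \<Upsilon>
               (\<omega>\<^sub>1 * of_real (X - A)) (\<omega>\<^sub>2 * of_real (Y - B))"
proof -
  \<comment> \<open>\<open>\<kappa>\<close> and \<open>\<rho>\<close> remain arguments so that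
    \<open>a\<close> gives the coefficients both before and after the parameter shift.\<close>
  define a where "a = (\<lambda>\<kappa> \<rho> s r. HK_coefficient \<gamma>\<^sub>1 \<gamma>\<^sub>2 \<gamma>\<^sub>3 \<gamma>\<^sub>4 \<kappa> \<rho> \<Upsilon> s r
      * \<omega>\<^sub>1 ^ s * branch_power k \<omega>\<^sub>2 \<Upsilon> ^ r)"
  \<comment> \<open>The possibly singular powers go into the integrable kernels \<open>K\<close> and
    \<open>L\<close>; the monomials \<open>\<phi>\<close> and \<open>\<psi>\<close> are bounded on
    the rectangle.\<close>
  define K where "K = (\<lambda>x. complex_of_real (X - x) powr (\<mu> - 1) * of_real (x - A) powr (\<kappa> - 1))"
  define L where "L = (\<lambda>y. complex_of_real (Y - y) powr (\<zeta> - 1) * of_real (y - B) powr (\<rho> - 1))"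
  define \<phi> where "\<phi> = (\<lambda>s x. complex_of_real (x - A) ^ s)"
  define \<psi> where "\<psi> = (\<lambda>r y. complex_of_real (y - B) powr (\<Upsilon> * of_nat r))"
  define U where "U = X - A"
  define V where "V = Y - B"
  have pos: "0 < U" "0 < V"
    using \<open>A < X\<close> \<open>B < Y\<close> by (auto simp: U_def V_def)
  \<comment> \<open>Used with the original parameters for the interchange and with the shifted ones
    for summability of the resulting series.\<close>
  have bound: "\<exists>P Q. summable P \<and> summable Q \<and>
      (\<forall>s r. norm (a \<kappa>' \<rho>' s r) * U ^ s * (V powr Re \<Upsilon>) ^ r \<le> P s * Q r)"
    if "0 < Re \<kappa>'" "0 < Re \<rho>'" for \<kappa>' \<rho>'
    unfolding a_def using assms pos that by (intro HK_coefficient_product_bound) auto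
  define E where "E = of_real U powr (\<kappa> + \<mu> - 1) * (of_real V powr (\<rho> + \<zeta> - 1) :: complex)"
  have K: "set_integrable lborel {A<..<X} K" and L: "set_integrable lborel {B<..<Y} L"
    unfolding K_def L_def using assms by (auto intro: set_integrable_powr_kernel simp del: of_real_diff)
  have \<phi>_le: "norm (\<phi> s x) \<le> U ^ s" if "x \<in> {A<..<X}" for s x
    using that unfolding \<phi>_def U_def norm_power norm_of_real by (intro power_mono) auto
  have \<psi>_le: "norm (\<psi> r y) \<le> (V powr Re \<Upsilon>) ^ r" if "y \<in> {B<..<Y}" for r y
  proof -
    have "norm (\<psi> r y) = (y - B) powr (Re \<Upsilon> * real r)"
      using that by (simp add: \<psi>_def norm_of_real_powr del: of_real_diff)
    also have "\<dots> \<le> V powr (Re \<Upsilon> * real r)"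
      using that \<open>0 < Re \<Upsilon>\<close> by (intro powr_mono2) (auto simp: V_def)
    also have "\<dots> = (V powr Re \<Upsilon>) ^ r"
      using pos by (simp add: powr_powr[symmetric] powr_realpow)
    finally show ?thesis .
  qed
  \<comment> \<open>The interval integrals run over open intervals, where \<open>y - B\<close> is
    positive, as \<open>HK_Mittag_Leffler_of_real\<close> requires.\<close>
  have "(LBINT y=B..Y. (LBINT x=A..X. of_real (X - x) powr (\<mu> - 1) * of_real (Y - y) powr (\<zeta> - 1)
        * (of_real (x - A) powr (\<kappa> - 1) * of_real (y - B) powr (\<rho> - 1)
          * HK_Mittag_Leffler k \<gamma>\<^sub>1 \<gamma>\<^sub>2 \<gamma>\<^sub>3 \<gamma>\<^sub>4 \<kappa> \<rho> \<Upsilon>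
              (\<omega>\<^sub>1 * of_real (x - A)) (\<omega>\<^sub>2 * of_real (y - B))))) =
      (LINT y:{B<..<Y}|lborel. LINT x:{A<..<X}|lborel.
         K x * L y * (\<Sum>s. \<Sum>r. a \<kappa> \<rho> s r * \<phi> s x * \<psi> r y))"
    using assms
    by (auto simp: interval_lebesgue_integral_le_eq K_def L_def a_def \<phi>_def \<psi>_def
        HK_Mittag_Leffler_of_real simp del: of_real_diff intro!: set_lebesgue_integral_cong)
  also have "\<dots> = (\<Sum>s. \<Sum>r. a \<kappa> \<rho> s r * (LINT x:{A<..<X}|lborel. K x * \<phi> s x)
      * (LINT y:{B<..<Y}|lborel. L y * \<psi> r y))"
  proof -
    obtain P Q where "summable P" "summable Q"
      "norm (a \<kappa> \<rho> s r) * U ^ s * (V powr Re \<Upsilon>) ^ r \<le> P s * Q r" for s r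
      using bound[of \<kappa> \<rho>] assms by blast
    then show ?thesis
      using pos \<phi>_le \<psi>_le
      by (intro double_set_integral_suminf[OF K L,
            where p = "\<lambda>s. U ^ s" and q = "\<lambda>r. (V powr Re \<Upsilon>) ^ r" and P = P and Q = Q])
        (auto simp: \<phi>_def \<psi>_def simp del: of_real_diff)
  qed
  also have "\<dots> = (\<Sum>s. \<Sum>r. Gamma \<zeta> * Gamma \<mu> * E *
      (a (\<kappa> + \<mu>) (\<rho> + \<zeta>) s r * of_real U ^ s * of_real V powr (\<Upsilon> * of_nat r)))"
  proof (intro suminf_cong)
    fix s r
    \<comment> \<open>The monomial is absorbed into the kernel by raising \<open>\<kappa>\<close> to
      \<open>\<kappa> + s\<close>. The open interval matters: \<open>0 powr 0\<close> is
      \<open>0\<close> whereas \<open>0 ^ 0\<close> is \<open>1\<close>.\<close>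
    have "(LINT x:{A<..<X}|lborel. K x * \<phi> s x) =
        (LINT x:{A<..<X}|lborel. of_real (X - x) powr (\<mu> - 1) * of_real (x - A) powr (\<kappa> + of_nat s - 1))"
      by (rule set_lebesgue_integral_cong)
        (auto simp: K_def \<phi>_def powr_complexpow[symmetric] algebra_simps
          simp del: powr_complexpow of_real_diff simp flip: powr_add)
    also have "\<dots> = of_real U powr (\<kappa> + of_nat s + \<mu> - 1) * Beta (\<kappa> + of_nat s) \<mu>"
      unfolding U_def using assms by (intro set_integral_powr_kernel) (auto simp: add_pos_nonneg)
    also have "of_real U powr (\<kappa> + of_nat s + \<mu> - 1) = of_real U powr (\<kappa> + \<mu> - 1) * (of_real U ^ s :: complex)"
      using pos by (simp add: algebra_simps flip: powr_complexpow powr_add)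
    finally have IK: "(LINT x:{A<..<X}|lborel. K x * \<phi> s x) =
        of_real U powr (\<kappa> + \<mu> - 1) * of_real U ^ s * Beta (\<kappa> + of_nat s) \<mu>" .
    have "(LINT y:{B<..<Y}|lborel. L y * \<psi> r y) =
        (LINT y:{B<..<Y}|lborel. of_real (Y - y) powr (\<zeta> - 1) * of_real (y - B) powr (\<rho> + \<Upsilon> * of_nat r - 1))"
      by (rule set_lebesgue_integral_cong)
        (auto simp: L_def \<psi>_def algebra_simps simp del: of_real_diff simp flip: powr_add)
    also have "\<dots> = of_real V powr (\<rho> + \<Upsilon> * of_nat r + \<zeta> - 1) * Beta (\<rho> + \<Upsilon> * of_nat r) \<zeta>"
      unfolding V_def using assms by (intro set_integral_powr_kernel) (auto simp: add_pos_nonneg)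
    also have "of_real V powr (\<rho> + \<Upsilon> * of_nat r + \<zeta> - 1) =
        of_real V powr (\<rho> + \<zeta> - 1) * (of_real V powr (\<Upsilon> * of_nat r) :: complex)"
      by (simp add: algebra_simps flip: powr_add)
    finally have IL: "(LINT y:{B<..<Y}|lborel. L y * \<psi> r y) =
        of_real V powr (\<rho> + \<zeta> - 1) * of_real V powr (\<Upsilon> * of_nat r) * Beta (\<rho> + \<Upsilon> * of_nat r) \<zeta>" .
    \<comment> \<open>The Gamma values dividing \<open>a \<kappa> \<rho> s r\<close> cancel against
      numerators of the Beta values, whose denominators are the Gamma values with shifted
      parameters.\<close>
    have "Gamma (\<kappa> + of_nat s) \<noteq> 0" "Gamma (\<rho> + \<Upsilon> * of_nat r) \<noteq> 0"
      using assms by (auto intro!: Gamma_nonzero_right_half_plane simp: add_pos_nonneg)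
    then have "a \<kappa> \<rho> s r * Beta (\<kappa> + of_nat s) \<mu> * Beta (\<rho> + \<Upsilon> * of_nat r) \<zeta> =
        Gamma \<zeta> * Gamma \<mu> * a (\<kappa> + \<mu>) (\<rho> + \<zeta>) s r"
      by (simp add: a_def HK_coefficient_def Beta_def add_ac mult_ac)
    then show "a \<kappa> \<rho> s r * (LINT x:{A<..<X}|lborel. K x * \<phi> s x) * (LINT y:{B<..<Y}|lborel. L y * \<psi> r y) =
      Gamma \<zeta> * Gamma \<mu> * E *
      (a (\<kappa> + \<mu>) (\<rho> + \<zeta>) s r * of_real U ^ s * of_real V powr (\<Upsilon> * of_nat r))"
      unfolding IK IL E_def by (simp add: algebra_simps)
  qed
  \<comment> \<open>The constant leaves both sums because the rows and the series of row sums
    converge, by the majorant for the shifted parameters.\<close>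
  also have "\<dots> = Gamma \<zeta> * Gamma \<mu> * E *
      (\<Sum>s. \<Sum>r. a (\<kappa> + \<mu>) (\<rho> + \<zeta>) s r * of_real U ^ s * of_real V powr (\<Upsilon> * of_nat r))"
  proof -
    obtain P Q where P: "summable P" and Q: "summable Q"
      and PQ: "norm (a (\<kappa> + \<mu>) (\<rho> + \<zeta>) s r) * U ^ s * (V powr Re \<Upsilon>) ^ r \<le> P s * Q r" for s r
      using bound[of "\<kappa> + \<mu>" "\<rho> + \<zeta>"] assms by auto
    have "norm (a (\<kappa> + \<mu>) (\<rho> + \<zeta>) s r * of_real U ^ s * of_real V powr (\<Upsilon> * of_nat r)) \<le> P s * Q r" for s r
      using PQ[of s r] pos
      by (simp add: norm_mult norm_power norm_of_real_powr powr_powr[symmetric] powr_realpow)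
    note summable = summable_inner_product_bound[OF this P Q] summable_outer_product_bound[OF this P Q]
    show ?thesis
      by (simp add: suminf_mult summable)
  qed
  also have "(\<Sum>s. \<Sum>r. a (\<kappa> + \<mu>) (\<rho> + \<zeta>) s r * of_real U ^ s * of_real V powr (\<Upsilon> * of_nat r)) =
      HK_Mittag_Leffler k \<gamma>\<^sub>1 \<gamma>\<^sub>2 \<gamma>\<^sub>3 \<gamma>\<^sub>4 (\<kappa> + \<mu>) (\<rho> + \<zeta>) \<Upsilon>
               (\<omega>\<^sub>1 * of_real U) (\<omega>\<^sub>2 * of_real V)"
    using assms pos by (simp add: HK_Mittag_Leffler_of_real a_def)
  finally show ?thesis
    unfolding double_fractional_integral_def
    using Gamma_nonzero_right_half_plane[OF \<open>0 < Re \<zeta>\<close>] Gamma_nonzero_right_half_plane[OF \<open>0 < Re \<mu>\<close>]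
    by (simp add: E_def U_def V_def)
qed

end
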